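(* Let $G$ be a connected simple graph on at least three vertices that has a perfect matching or a nearly perfect matching. Then there exist a vertex $v$ of $G$, a neighbour $u$ of $v$ in $G$, and an edge weighting $w$ of $G\setminus\{v\}$ such that $G\setminus\{v\}$ is $\mathrm{SRSI}_w(u)$ and $G$ is obtained from $(G\setminus\{v\},w)$ by graph expansion at $u$ by $v$.
   Context: A matching in a graph is a set of pairwise disjoint edges; a $k$-matching is a matching of size $k$. A matching is perfect if it saturates (covers) all vertices, and nearly perfect if it saturates all but exactly one vertex. An edge weighting (weight function) of a simple graph $G=(V,E)$ is a function $w:E\to\mathbb{R}^+$ to the positive reals. For a weighted graph on $n$ vertices, the weighted matching polynomial is $$m_w(G,x)=\sum_{k=0}^{\lfloor n/2\rfloor}(-1)^k\mu_w(G,k)\,x^{n-2k},\qquad \mu_w(G,k)=\sum_{M\text{ a }k\text{-matching of }G}\ \prod_{e\in M}w(e),$$ with $\mu_w(G,0)=1$. On subgraphs, $w$ is understood to be restricted. $G\setminus\{v\}$ denotes the graph obtained by deleting the vertex $v$. All roots of $m_w(G,x)$ are real. A weighted graph $H=(V,E,w)$ on $n\ge 2$ vertices is $\mathrm{SRSI}_w(u)$, where $u\in V$, if: (1) $m_w(H,x)$ has simple roots $\lambda_1<\dots<\lambda_n$; and (2) $m_w(H\setminus\{u\},x)$ has simple roots $\mu_1<\dots<\mu_{n-1}$ that strictly interlace those of $m_w(H,x)$, i.e. $\lambda_1<\mu_1<\lambda_2<\dots<\mu_{n-1}<\lambda_n$. Graph expansion: given a weighted graph $\widehat{G}=(\widehat{V},\widehat{E},\widehat{w})$,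 a vertex $u\in\widehat{V}$ and a new vertex $v\notin\widehat{V}$, a graph expansion of $\widehat{G}$ at $u$ by $v$ is a graph $G$ with vertex set $\widehat{V}\cup\{v\}$ and edge set $\widehat{E}\cup\{\hat e_1,\dots,\hat e_s\}$, $s\ge 1$, where $\hat e_1=\{u,v\}$ and, for $i\ge 2$, $\hat e_i=\{v,v_i\}$ for some $v_i\in\widehat{V}$ with $v_i\ne u$; its weight function agrees with $\widehat{w}$ on $\widehat{E}$, and the new edges may have arbitrary (positive) weights. In the claim, $G$ itself carries no prescribed weights, so the edges at $v$ may be given any positive weights. *)

theory Defs
  imports Complex_Main "HOL-Computational_Algebra.Polynomial"
begin

text \<open>
  A graph is a vertex set \<open>V\<close> together with a set \<open>E\<close> of two-element subsets of \<open>V\<close>.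
  Weights are total functions on vertex sets of which only the values on \<open>E\<close> matter, so restricting
  a weight function to a subgraph leaves the function unchanged.
\<close>

definition simple_graph :: "'a set \<Rightarrow> 'a set set \<Rightarrow> bool" where
  "simple_graph V E \<longleftrightarrow> finite V \<and> (\<forall>e\<in>E. e \<subseteq> V \<and> card e = 2)"

definition connected_graph :: "'a set \<Rightarrow> 'a set set \<Rightarrow> bool" where
  "connected_graph V E \<longleftrightarrow> V \<noteq> {} \<and> (\<forall>x\<in>V. \<forall>y\<in>V. (x, y) \<in> {(a, b). {a, b} \<in> E}\<^sup>*)"

definition delete_vertex_edges :: "'a set set \<Rightarrow> 'a \<Rightarrow> 'a set set" where
  "delete_vertex_edges E v = {e \<in> E. v \<notin> e}"

definition edge_weighting :: "'a set set \<Rightarrow> ('a set \<Rightarrow> real) \<Rightarrow> bool" where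
  "edge_weighting E w \<longleftrightarrow> (\<forall>e\<in>E. 0 < w e)"

definition weighted_graph :: "'a set \<Rightarrow> 'a set set \<Rightarrow> ('a set \<Rightarrow> real) \<Rightarrow> bool" where
  "weighted_graph V E w \<longleftrightarrow> simple_graph V E \<and> edge_weighting E w"

definition is_matching :: "'a set set \<Rightarrow> 'a set set \<Rightarrow> bool" where
  "is_matching E M \<longleftrightarrow> M \<subseteq> E \<and> pairwise disjnt M"

definition perfect_matching :: "'a set \<Rightarrow> 'a set set \<Rightarrow> 'a set set \<Rightarrow> bool" where
  "perfect_matching V E M \<longleftrightarrow> is_matching E M \<and> \<Union>M = V"

definition nearly_perfect_matching :: "'a set \<Rightarrow> 'a set set \<Rightarrow> 'a set set \<Rightarrow> bool" where
  "nearly_perfect_matching V E M \<longleftrightarrow> is_matching E M \<and> (\<exists>x\<in>V. \<Union>M = V - {x})"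

definition matching_weight :: "'a set set \<Rightarrow> ('a set \<Rightarrow> real) \<Rightarrow> nat \<Rightarrow> real" where
  "matching_weight E w k = (\<Sum>M\<in>{M. is_matching E M \<and> card M = k}. \<Prod>e\<in>M. w e)"

definition matching_poly :: "'a set \<Rightarrow> 'a set set \<Rightarrow> ('a set \<Rightarrow> real) \<Rightarrow> real poly" where
  "matching_poly V E w =
     (\<Sum>k = 0..card V div 2. monom ((-1) ^ k * matching_weight E w k) (card V - 2 * k))"

text \<open>The roots of \<open>p\<close> are exactly \<open>r 1 < \<dots> < r n\<close>, all of multiplicity one.\<close>

definition simple_roots :: "real poly \<Rightarrow> nat \<Rightarrow> (nat \<Rightarrow> real) \<Rightarrow> bool" where
  "simple_roots p n r \<longleftrightarrow>
     strict_mono_on {1..n} r \<and> {x. poly p x = 0} = r ` {1..n} \<and> (\<forall>i\<in>{1..n}. order (r i) p = 1)"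

definition SRSI :: "'a set \<Rightarrow> 'a set set \<Rightarrow> ('a set \<Rightarrow> real) \<Rightarrow> 'a \<Rightarrow> bool" where
  "SRSI V E w u \<longleftrightarrow>
     weighted_graph V E w \<and> 2 \<le> card V \<and> u \<in> V \<and>
     (\<exists>l m. simple_roots (matching_poly V E w) (card V) l \<and>
            simple_roots (matching_poly (V - {u}) (delete_vertex_edges E u) w) (card V - 1) m \<and>
            (\<forall>i\<in>{1..card V - 1}. l i < m i \<and> m i < l (i + 1)))"

text \<open>
  The weighted graph \<open>(V, E, w)\<close> is an expansion of \<open>(V', E', w')\<close> at \<open>u\<close> by \<open>v\<close>.
  The set \<open>S\<close> collects the further neighbours of \<open>v\<close> and may be empty.
\<close>

definition graph_expansion ::
  "'a set \<Rightarrow> 'a set set \<Rightarrow> ('a set \<Rightarrow> real) \<Rightarrow> 'a \<Rightarrow> 'a \<Rightarrow>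
   'a set \<Rightarrow> 'a set set \<Rightarrow> ('a set \<Rightarrow> real) \<Rightarrow> bool" where
  "graph_expansion V' E' w' u v V E w \<longleftrightarrow>
     weighted_graph V' E' w' \<and> u \<in> V' \<and> v \<notin> V' \<and>
     V = insert v V' \<and>
     (\<exists>S. S \<subseteq> V' - {u} \<and> E = E' \<union> {{u, v}} \<union> (\<lambda>x. {v, x}) ` S) \<and>
     (\<forall>e\<in>E'. w e = w' e) \<and> edge_weighting E w"

end

theory Submission
  imports Defs
begin

text \<open>
  Write \<open>A, B\<close> for the matching polynomials of a weighted tree \<open>S\<close> and of \<open>S - r\<close>, and \<open>C, D\<close> for
  those of a disjoint tree \<open>T\<close> and of \<open>T - u\<close>. Joining the trees by an edge \<open>ru\<close> of weight \<open>w\<close> gives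
  the pair \<open>A C - w B D\<close>, \<open>B C\<close>, whose Wronskian is \<open>C\<^sup>2 W(A, B) + w B\<^sup>2 W(C, D)\<close>. Since strict
  interlacing amounts to a positive Wronskian together with real-rootedness of the second polynomial,
  it survives the join as soon as \<open>B\<close> and \<open>C\<close> have no common root. Rescaling the weights of \<open>T\<close> moves
  every nonzero root of \<open>C\<close>, so only the root \<open>0\<close> can obstruct, and that is ruled out by parity.
  Following a perfect or nearly perfect matching outwards shows that for a suitable edge \<open>uv\<close> of \<open>G\<close>
  some spanning tree of \<open>G - v\<close>, rooted at \<open>u\<close>, can be assembled by such joins. The remaining edges of
  \<open>G - v\<close> are then given a small common weight, which does not destroy strict interlacing.
\<close>

section \<open>Strict interlacing and the Wronskian\<close>

text \<open>The derivative of \<open>q / p\<close> is minus this over the square of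
  \<open>p\<close>, so a positive Wronskian means that \<open>q / p\<close> decreases between its
  poles.\<close>

definition wronskian :: "real poly \<Rightarrow> real poly \<Rightarrow> real poly" where
  "wronskian p q = pderiv p * q - p * pderiv q"

text \<open>No roots are named: the counts make all roots real and simple, and the sign of the
  Wronskian makes them alternate (\<open>interlacing_roots\<close>). This form suits algebraic
  identities such as the one for joins.\<close>

definition interlacing :: "real poly \<Rightarrow> real poly \<Rightarrow> bool" where
  "interlacing p q \<longleftrightarrow>
     degree p = Suc (degree q) \<and> lead_coeff p = 1 \<and> lead_coeff q = 1 \<and>
     card {x. poly p x = 0} = degree p \<and> card {x. poly q x = 0} = degree q \<and>
     (\<forall>x. 0 < poly (wronskian p q) x)"

lemma has_field_derivative_poly_quotient:
  assumes "poly p x \<noteq> 0"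
  shows "((\<lambda>x. poly q x / poly p x) has_real_derivative
           - poly (wronskian p q) x / (poly p x)\<^sup>2) (at x)"
  by (rule derivative_eq_intros poly_DERIV assms refl)+
     (simp add: wronskian_def power2_eq_square)

text \<open>Otherwise \<open>q / p\<close> would be differentiable on the closed interval and zero
  at both ends, and the mean value theorem would produce a zero of the Wronskian.\<close>

lemma wronskian_root_between:
  assumes W: "\<And>x. poly (wronskian p q) x \<noteq> 0"
    and "a < b" "poly q a = 0" "poly q b = 0"
  shows "\<exists>x>a. x < b \<and> poly p x = 0"
proof (rule ccontr)
  assume "\<not> ?thesis"
  then have no: "poly p x \<noteq> 0" if "a < x" "x < b" for x using that by auto
  have ends: "poly p a \<noteq> 0" "poly p b \<noteq> 0"
    using W[of a] W[of b] assms(3,4) by (auto simp: wronskian_def)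
  have no': "poly p x \<noteq> 0" if "a \<le> x" "x \<le> b" for x
    using no ends that by (cases "x = a \<or> x = b") auto
  note D = has_field_derivative_poly_quotient[of p _ q]
  have "\<exists>z. a < z \<and> z < b \<and> (\<lambda>x. poly q x / poly p x) b - (\<lambda>x. poly q x / poly p x) a
      = (b - a) * (- poly (wronskian p q) z / (poly p z)\<^sup>2)"
    using \<open>a < b\<close> by (intro MVT2 D no') auto
  then obtain z where "a < z" "z < b" "poly (wronskian p q) z / (poly p z)\<^sup>2 = 0"
    using assms(2-4) by auto
  then show False using W no by simp
qed

lemma quotient_decreasing:
  assumes W: "\<And>x. 0 < poly (wronskian p q) x"
    and "a < b" and no: "\<And>x. a \<le> x \<Longrightarrow> x \<le> b \<Longrightarrow> poly p x \<noteq> 0"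
  shows "poly q b / poly p b < poly q a / poly p a"
proof (rule DERIV_neg_imp_decreasing[OF \<open>a < b\<close>])
  fix x assume x: "a \<le> x" "x \<le> b"
  show "\<exists>y. ((\<lambda>x. poly q x / poly p x) has_real_derivative y) (at x) \<and> y < 0"
    using has_field_derivative_poly_quotient[OF no[OF x]] W[of x] no[OF x]
    by (intro exI conjI) (assumption, simp add: divide_neg_pos)
qed

lemma poly_eventually_pos:
  fixes p :: "real poly"
  assumes "0 < lead_coeff p"
  shows "\<exists>n. \<forall>x\<ge>n. 0 < poly p x"
  using poly_pinfty_gt_lc[OF assms] assms by (meson less_le_trans)

lemma odd_poly_eventually_neg:
  fixes p :: "real poly"
  assumes "0 < lead_coeff p" "odd (degree p)"
  shows "\<exists>n. \<forall>x\<le>n. poly p x < 0"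
proof -
  have "lead_coeff (- pcompose p [:0, -1:]) = lead_coeff p"
    using assms(2) by (simp add: lead_coeff_comp)
  then obtain n where "\<And>x. x \<ge> n \<Longrightarrow> 0 < poly (- pcompose p [:0, -1:]) x"
    using poly_eventually_pos[of "- pcompose p [:0, -1:]"] assms(1) by auto
  then have "poly p x < 0" if "x \<le> - n" for x
    using that by (force simp: poly_pcompose dest: spec[of _ "- x"])
  then show ?thesis by blast
qed

text \<open>The root count of \<open>p\<close> is a consequence: roots of \<open>p\<close> separate
  those of \<open>q\<close> and also occur beyond the extreme ones, which gives
  \<open>degree q + 1\<close> of them.\<close>

lemma interlacingI:
  assumes deg: "degree p = Suc (degree q)" "lead_coeff p = 1" "lead_coeff q = 1"
    and card_q: "card {x. poly q x = 0} = degree q"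
    and W: "\<And>x. 0 < poly (wronskian p q) x"
  shows "interlacing p q"
proof -
  let ?P = "{x. poly p x = 0}" and ?Q = "{x. poly q x = 0}"
  have nz: "p \<noteq> 0" "q \<noteq> 0" using deg by auto
  then have fin: "finite ?P" "finite ?Q" by (auto simp: poly_roots_finite)
  have W': "poly (wronskian p q) x \<noteq> 0" for x using W[of x] by simp
  \<comment> \<open>At a root of \<open>q\<close> the decreasing function \<open>q / p\<close> vanishes; its sign at \<open>\<plusminus>\<infinity>\<close> then forces a pole on
    either side.\<close>
  have lc: "lead_coeff (p * q) = 1" "odd (degree (p * q))"
    using deg nz by (simp only: lead_coeff_mult, simp) (simp add: degree_mult_eq deg)
  obtain N where N: "\<And>x. x \<ge> N \<Longrightarrow> 0 < poly p x * poly q x"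
    using poly_eventually_pos[of "p * q"] lc by auto
  obtain L where L: "\<And>x. x \<le> L \<Longrightarrow> poly p x * poly q x < 0"
    using odd_poly_eventually_neg[of "p * q"] lc by auto
  have after: "\<exists>y>x. poly p y = 0" if x: "poly q x = 0" for x
  proof (rule ccontr)
    assume "\<not> ?thesis"
    moreover have "poly p x \<noteq> 0" using W'[of x] x by (auto simp: wronskian_def)
    ultimately have "poly p y \<noteq> 0" if "x \<le> y" for y using that by (cases "x = y") auto
    then have "poly q (max N (x + 1)) / poly p (max N (x + 1)) < 0"
      using quotient_decreasing[OF W, of x "max N (x+1)"] x by auto
    with N[of "max N (x + 1)"] show False by (auto simp: divide_less_0_iff zero_less_mult_iff)
  qed
  have before: "\<exists>y<x. poly p y = 0" if x: "poly q x = 0" for x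
  proof (rule ccontr)
    assume "\<not> ?thesis"
    moreover have "poly p x \<noteq> 0" using W'[of x] x by (auto simp: wronskian_def)
    ultimately have "poly p y \<noteq> 0" if "y \<le> x" for y using that by (cases "x = y") auto
    then have "poly q (min L (x - 1)) / poly p (min L (x - 1)) > 0"
      using quotient_decreasing[OF W, of "min L (x - 1)" x] x by auto
    with L[of "min L (x - 1)"] show False by (auto simp: zero_less_divide_iff mult_less_0_iff)
  qed
  have "\<exists>x. poly p x = 0"
  proof -
    \<comment> \<open>A constant \<open>q\<close> leaves \<open>p\<close> linear, and the
      intermediate value theorem applies; otherwise \<open>after\<close> turns a root of
      \<open>q\<close> into one of \<open>p\<close>.\<close>
    have "odd (degree p) \<or> degree q > 0" using deg by (cases "degree q") auto
    then show ?thesis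
    proof
      assume "odd (degree p)"
      then obtain a b where a: "\<forall>x\<ge>a. 0 < poly p x" and b: "\<forall>x\<le>b. poly p x < 0"
        using poly_eventually_pos[of p] odd_poly_eventually_neg[of p] deg by auto
      then have "poly p (min (b - 1) a) < 0" "0 < poly p (max a b)" "min (b - 1) a < max a b" by auto
      then show ?thesis using poly_IVT_pos by blast
    next
      assume "degree q > 0"
      with card_q have "?Q \<noteq> {}" by (metis card.empty less_irrefl)
      then show ?thesis using after by blast
    qed
  qed
  then have P_ne: "?P \<noteq> {}" by blast
  \<comment> \<open>Each root of \<open>q\<close> is sent to the following root of \<open>p\<close>.
    This is injective, as a root of \<open>p\<close> lies between any two roots of \<open>q\<close>,
    and by \<open>before\<close> it misses the least root of \<open>p\<close>.\<close>
  define nxt where "nxt x = Min {y. x < y \<and> poly p y = 0}" for x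
  have nxt: "x < nxt x" "poly p (nxt x) = 0" "\<And>y. x < y \<Longrightarrow> poly p y = 0 \<Longrightarrow> nxt x \<le> y"
    if "poly q x = 0" for x
  proof -
    have f: "finite {y. x < y \<and> poly p y = 0}" by (rule finite_subset[OF _ fin(1)]) auto
    moreover have "{y. x < y \<and> poly p y = 0} \<noteq> {}" using after[OF that] by auto
    ultimately have "nxt x \<in> {y. x < y \<and> poly p y = 0}" unfolding nxt_def by (rule Min_in)
    then show "x < nxt x" "poly p (nxt x) = 0" by auto
    show "nxt x \<le> y" if "x < y" "poly p y = 0" for y
      unfolding nxt_def using f that by (intro Min_le) auto
  qed
  have less: "nxt x < nxt y" if xy: "poly q x = 0" "poly q y = 0" "x < y" for x y
  proof -
    obtain z where "x < z" "z < y" "poly p z = 0"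
      using wronskian_root_between[OF W' xy(3,1,2)] by auto
    then show ?thesis using nxt(3)[OF xy(1), of z] nxt(1)[OF xy(2)] by linarith
  qed
  have inj: "inj_on nxt ?Q"
    by (rule inj_onI) (metis less less_irrefl linorder_neqE_linordered_idom mem_Collect_eq)
  have "Min ?P \<notin> nxt ` ?Q"
  proof
    assume "Min ?P \<in> nxt ` ?Q"
    then obtain x where x: "poly q x = 0" "Min ?P = nxt x" by auto
    obtain y where "y < x" "poly p y = 0" using before[OF x(1)] by auto
    then have "Min ?P \<le> y" using fin by simp
    then show False using x nxt(1)[OF x(1)] \<open>y < x\<close> by simp
  qed
  then have "card (insert (Min ?P) (nxt ` ?Q)) = Suc (degree q)"
    using fin card_q by (simp add: card_image[OF inj])
  moreover have "insert (Min ?P) (nxt ` ?Q) \<subseteq> ?P" using Min_in[OF fin(1) P_ne] nxt(2) by auto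
  ultimately have "Suc (degree q) \<le> card ?P" using card_mono[OF fin(1)] by metis
  then have "card ?P = degree p" using card_poly_roots_bound[OF nz(1)] deg by simp
  then show ?thesis using assms by (simp add: interlacing_def)
qed

text \<open>\<open>coprime\<close> acts twice: it keeps the roots of \<open>B * C\<close> distinct,
  and at a root of \<open>B\<close>, where the second summand of the Wronskian vanishes, it makes
  the first one positive. Elsewhere the second summand is positive.\<close>

lemma interlacing_join:
  assumes "interlacing A B" "interlacing C D" "0 < w"
    and coprime: "\<And>x. poly B x = 0 \<Longrightarrow> poly C x \<noteq> 0"
  shows "interlacing (A * C - smult w (B * D)) (B * C)"
proof (rule interlacingI)
  note AB = assms(1)[unfolded interlacing_def] and CD = assms(2)[unfolded interlacing_def]
  have nz: "A \<noteq> 0" "B \<noteq> 0" "C \<noteq> 0" "D \<noteq> 0" using AB CD by auto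
  have d: "degree (smult w (B * D)) < degree (A * C)"
    using AB CD nz by (simp add: degree_mult_eq)
  then have d': "degree (A * C - smult w (B * D)) = degree (A * C)"
    using degree_add_eq_left[of "- smult w (B * D)" "A * C"] by simp
  then show "degree (A * C - smult w (B * D)) = Suc (degree (B * C))"
    using AB CD nz by (simp add: degree_mult_eq)
  show "lead_coeff (B * C) = 1" using AB CD by (metis lead_coeff_mult mult_1)
  have "lead_coeff (A * C - smult w (B * D)) = lead_coeff (A * C)"
    using d unfolding d' by (simp only: coeff_diff coeff_eq_0 diff_zero)
  then show "lead_coeff (A * C - smult w (B * D)) = 1"
    using AB CD by (metis lead_coeff_mult mult_1)
  have "{x. poly (B * C) x = 0} = {x. poly B x = 0} \<union> {x. poly C x = 0}" by auto
  moreover have "{x. poly B x = 0} \<inter> {x. poly C x = 0} = {}" using coprime by auto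
  ultimately show "card {x. poly (B * C) x = 0} = degree (B * C)"
    using AB CD nz by (simp add: card_Un_disjoint poly_roots_finite degree_mult_eq)
  fix x
  have "wronskian (A * C - smult w (B * D)) (B * C)
      = C^2 * wronskian A B + smult w (B^2 * wronskian C D)"
    by (simp add: wronskian_def pderiv_mult pderiv_diff pderiv_smult algebra_simps power2_eq_square
        smult_diff_right smult_add_right)
  then have "poly (wronskian (A * C - smult w (B * D)) (B * C)) x
      = (poly C x)^2 * poly (wronskian A B) x + w * ((poly B x)^2 * poly (wronskian C D) x)"
    by simp
  also have "0 < \<dots>"
  proof (cases "poly B x = 0")
    case True
    then show ?thesis using coprime AB by simp
  next
    case False
    then show ?thesis using AB CD \<open>0 < w\<close>
      by (intro add_nonneg_pos mult_nonneg_nonneg mult_pos_pos) (auto simp: less_imp_le)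
  qed
  finally show "0 < poly (wronskian (A * C - smult w (B * D)) (B * C)) x" .
qed

text \<open>Every root is multiplied by \<open>s\<close>, and the powers of \<open>s\<close> restore
  leading coefficient 1. On matching polynomials this amounts to multiplying all weights by
  \<open>s\<^sup>2\<close> (\<open>matching_poly_scale\<close>).\<close>

lemma interlacing_scale:
  assumes "interlacing p q" and s: "0 < s"
  shows "interlacing (smult (s ^ degree p) (pcompose p [:0, 1 / s:]))
                     (smult (s ^ degree q) (pcompose q [:0, 1 / s:]))"
    (is "interlacing ?p ?q")
proof (rule interlacingI)
  note pq = assms(1)[unfolded interlacing_def]
  show "degree ?p = Suc (degree ?q)" using s pq by (simp add: degree_pcompose)
  have "lead_coeff (smult (s ^ degree r) (pcompose r [:0, 1 / s:])) = lead_coeff r" for r :: "real poly"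
    using s by (simp only: lead_coeff_smult) (simp add: lead_coeff_comp power_divide)
  then show "lead_coeff ?p = 1" "lead_coeff ?q = 1" using pq by metis+
  have "{x. poly ?q x = 0} = (\<lambda>x. s * x) ` {x. poly q x = 0}"
    using s by (force simp: poly_pcompose image_iff intro: exI[of _ "_ / s"])
  then show "card {x. poly ?q x = 0} = degree ?q"
    using s pq by (simp add: card_image inj_on_def degree_pcompose)
  fix x
  have "wronskian ?p ?q = smult (s ^ degree p * s ^ degree q / s) (pcompose (wronskian p q) [:0, 1/s:])"
    using s by (simp add: wronskian_def pderiv_smult pderiv_pcompose pderiv_pCons pcompose_diff
        pcompose_mult smult_diff_right algebra_simps)
  then show "0 < poly (wronskian ?p ?q) x"
    using s pq by (simp add: poly_pcompose)
qed

section \<open>Counting and enumerating simple roots\<close>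

text \<open>One factor of a multiple root could be divided out without losing a root, leaving too
  many roots for the smaller degree.\<close>

lemma order_eq_1_if_card_roots:
  fixes p :: "real poly"
  assumes "p \<noteq> 0" "card {x. poly p x = 0} = degree p" "poly p a = 0"
  shows "order a p = 1"
proof -
  have "\<not> [:- a, 1:] ^ 2 dvd p"
  proof
    assume "[:- a, 1:] ^ 2 dvd p"
    then obtain k where k: "p = [:- a, 1:] * ([:- a, 1:] * k)"
      by (elim dvdE) (simp only: power2_eq_square mult.assoc)
    let ?r = "[:- a, 1:] * k"
    have r: "?r \<noteq> 0" using k assms(1) by auto
    have "{x. poly p x = 0} = {x. poly ?r x = 0}" using k by auto
    then have "degree p \<le> degree ?r" using card_poly_roots_bound[OF r] assms(2) by simp
    moreover have "degree p = Suc (degree ?r)"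
      using r by (subst k, subst degree_mult_eq) auto
    ultimately show False by simp
  qed
  then have "order a p < 2" using assms(1) order_divides by (metis not_less)
  moreover have "order a p \<noteq> 0" using assms order_root by blast
  ultimately show ?thesis by simp
qed

lemma simple_rootsI:
  assumes "p \<noteq> 0" "degree p = n" "strict_mono_on {1..n} r"
    and "\<And>i. i \<in> {1..n} \<Longrightarrow> poly p (r i) = 0"
  shows "simple_roots p n r"
proof -
  have c: "card (r ` {1..n}) = n"
    using assms(3) by (simp add: card_image strict_mono_on_imp_inj_on)
  have "r ` {1..n} = {x. poly p x = 0}"
    using assms c card_poly_roots_bound[OF assms(1)]
    by (intro card_seteq) (auto simp: poly_roots_finite)
  then show ?thesis
    using assms c order_eq_1_if_card_roots[OF assms(1)] by (auto simp: simple_roots_def)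
qed

lemma finite_real_enumeration:
  fixes R :: "real set"
  assumes "finite R"
  obtains l where "strict_mono_on {1..card R} l" "l ` {1..card R} = R"
proof -
  \<comment> \<open>The index is shifted because \<open>simple_roots\<close> numbers the roots from
    1.\<close>
  let ?l = "\<lambda>i. sorted_list_of_set R ! (i - 1)"
  have "sorted_wrt (<) (sorted_list_of_set R)" by simp
  then have "strict_mono_on {1..card R} ?l"
    by (intro strict_mono_onI sorted_wrt_nth_less[of "(<)"]) auto
  moreover have "?l ` {1..card R} = R"
  proof -
    have "?l ` {1..card R} = (\<lambda>i. sorted_list_of_set R ! i) ` {0..<card R}"
      by (force simp: image_iff intro: bexI[of _ "Suc _"])
    also have "\<dots> = set (sorted_list_of_set R)"
      by (simp add: set_conv_nth atLeast0LessThan image_def)  (auto simp: )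
    finally show ?thesis using assms by simp
  qed
  ultimately show ?thesis using that by blast
qed

text \<open>Exchanging the polynomials only changes the sign of the Wronskian, so consecutive roots
  of \<open>p\<close> enclose a root of \<open>q\<close>. There are \<open>degree q\<close> gaps, so
  these are all the roots of \<open>q\<close>.\<close>

lemma interlacing_roots:
  assumes "interlacing p q"
  obtains l m where "l ` {1..degree p} = {x. poly p x = 0}"
    "m ` {1..degree q} = {x. poly q x = 0}"
    "\<And>i. i \<in> {1..degree q} \<Longrightarrow> l i < m i \<and> m i < l (i + 1)"
proof -
  note pq = assms[unfolded interlacing_def]
  have fin: "finite {x. poly p x = 0}" "finite {x. poly q x = 0}"
    using pq by (auto intro!: poly_roots_finite)
  obtain l where l: "strict_mono_on {1..degree p} l" "l ` {1..degree p} = {x. poly p x = 0}"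
    using finite_real_enumeration[OF fin(1)] pq by metis
  have W: "poly (wronskian q p) x \<noteq> 0" for x
    using pq[THEN conjunct2, THEN conjunct2, THEN conjunct2, THEN conjunct2, THEN conjunct2, rule_format, of x]
    by (auto simp: wronskian_def algebra_simps)
  have "\<exists>x. l i < x \<and> x < l (i + 1) \<and> poly q x = 0" if "i \<in> {1..degree q}" for i
  proof -
    have i: "i \<in> {1..degree p}" "i + 1 \<in> {1..degree p}" using that pq by auto
    then have "l i < l (i + 1)" using l(1) by (auto simp: strict_mono_on_def)
    moreover have "poly p (l i) = 0" "poly p (l (i + 1)) = 0" using i l(2) by auto
    ultimately show ?thesis using wronskian_root_between[OF W, of "l i" "l (i + 1)"] by auto
  qed
  then obtain m where m: "\<And>i. i \<in> {1..degree q} \<Longrightarrow> l i < m i \<and> m i < l (i + 1) \<and> poly q (m i) = 0"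
    by metis
  have "strict_mono_on {1..degree q} m"
  proof (rule strict_mono_onI)
    fix i j assume ij: "i \<in> {1..degree q}" "j \<in> {1..degree q}" "i < j"
    have "l (i + 1) \<le> l j"
      using ij pq l(1) by (cases "i + 1 = j") (auto simp: strict_mono_on_def less_imp_le)
    then show "m i < m j" using m[OF ij(1)] m[OF ij(2)] by linarith
  qed
  then have "card (m ` {1..degree q}) = card {x. poly q x = 0}"
    using pq by (simp add: card_image strict_mono_on_imp_inj_on)
  then have "m ` {1..degree q} = {x. poly q x = 0}"
    using m fin by (intro card_subset_eq) auto
  then show ?thesis using that l m by blast
qed

section \<open>Stability of strict interlacing under perturbation\<close>

lemma simple_root_sign_change:
  fixes p :: "real poly"
  assumes "poly p a = 0" "poly (pderiv p) a \<noteq> 0"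
  shows "\<forall>\<^sub>F d in at_right 0. poly p (a - d) * poly p (a + d) < 0"
proof -
  have *: "\<forall>\<^sub>F d in at_right 0. poly p (a - d) * poly p (a + d) < 0"
    if p: "poly p a = 0" "poly (pderiv p) a > 0" for p
  proof -
    obtain d1 where d1: "d1 > 0" "\<forall>h>0. h < d1 \<longrightarrow> poly p a < poly p (a + h)"
      using DERIV_pos_inc_right[OF poly_DERIV p(2)] by auto
    obtain d2 where d2: "d2 > 0" "\<forall>h>0. h < d2 \<longrightarrow> poly p (a - h) < poly p a"
      using DERIV_pos_inc_left[OF poly_DERIV p(2)] by auto
    show ?thesis unfolding eventually_at_right_field
      using d1 d2 p(1) by (intro exI[of _ "min d1 d2"]) (auto intro: mult_neg_pos)
  qed
  show ?thesis
    using *[of p] *[of "- p"] assms by (cases "poly (pderiv p) a > 0") (auto simp: pderiv_minus)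
qed

text \<open>Small separated intervals surround the roots, with a sign change across each. Only
  finitely many endpoint values matter, so pointwise convergence preserves the signs and each
  interval keeps a root; the fixed degrees leave no room for others.\<close>

lemma interlacing_perturb:
  fixes P Q :: "'b \<Rightarrow> real poly"
  assumes pq: "interlacing p q"
    and P: "\<And>x. ((\<lambda>e. poly (P e) x) \<longlongrightarrow> poly p x) F"
    and Q: "\<And>x. ((\<lambda>e. poly (Q e) x) \<longlongrightarrow> poly q x) F"
    and degs: "\<And>e. degree (P e) = degree p" "\<And>e. degree (Q e) = degree q"
    and nz: "\<And>e. P e \<noteq> 0" "\<And>e. Q e \<noteq> 0"
  shows "\<forall>\<^sub>F e in F. \<exists>l m. simple_roots (P e) (degree p) l \<and> simple_roots (Q e) (degree q) m \<and>
           (\<forall>i\<in>{1..degree q}. l i < m i \<and> m i < l (i + 1))"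
proof -
  have deg: "degree p = Suc (degree q)" and W: "\<And>x. 0 < poly (wronskian p q) x"
    using pq by (auto simp: interlacing_def)
  obtain l m where l: "l ` {1..degree p} = {x. poly p x = 0}"
    and m: "m ` {1..degree q} = {x. poly q x = 0}"
    and lm: "\<And>i. i \<in> {1..degree q} \<Longrightarrow> l i < m i \<and> m i < l (i + 1)"
    using interlacing_roots[OF pq] by blast
  let ?gaps = "\<lambda>d. (\<forall>i\<in>{1..degree p}. poly p (l i - d) * poly p (l i + d) < 0) \<and>
      (\<forall>i\<in>{1..degree q}. poly q (m i - d) * poly q (m i + d) < 0) \<and>
      (\<forall>i\<in>{1..degree q}. l i + d < m i - d \<and> m i + d < l (i + 1) - d)"
  have "\<forall>\<^sub>F d in at_right (0::real). ?gaps d"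
  proof (intro eventually_conj eventually_ball_finite ballI)
    fix i assume "i \<in> {1..degree p}"
    then have "poly p (l i) = 0" using l by auto
    moreover from this have "poly (pderiv p) (l i) \<noteq> 0"
      using W[of "l i"] by (auto simp: wronskian_def)
    ultimately show "\<forall>\<^sub>F d in at_right 0. poly p (l i - d) * poly p (l i + d) < 0"
      by (rule simple_root_sign_change)
  next
    fix i assume i: "i \<in> {1..degree q}"
    then have "poly q (m i) = 0" using m by auto
    moreover from this have "poly (pderiv q) (m i) \<noteq> 0"
      using W[of "m i"] by (auto simp: wronskian_def)
    ultimately show "\<forall>\<^sub>F d in at_right 0. poly q (m i - d) * poly q (m i + d) < 0"
      by (rule simple_root_sign_change)
    show "\<forall>\<^sub>F d in at_right 0. l i + d < m i - d"
      unfolding eventually_at_right_field using lm[OF i]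
      by (intro exI[of _ "(m i - l i) / 2"]) (auto simp: field_simps)
    show "\<forall>\<^sub>F d in at_right 0. m i + d < l (i + 1) - d"
      unfolding eventually_at_right_field using lm[OF i]
      by (intro exI[of _ "(l (i + 1) - m i) / 2"]) (auto simp: field_simps)
  qed auto
  then have "\<forall>\<^sub>F d in at_right (0::real). 0 < d \<and> ?gaps d"
    by (rule eventually_conj[OF eventually_at_right_less])
  then obtain d where "0 < d" and d: "?gaps d"
    using eventually_happens'[OF trivial_limit_at_right_real] by (metis (no_types, lifting))
  have "\<forall>\<^sub>F e in F. (\<forall>i\<in>{1..degree p}. poly (P e) (l i - d) * poly (P e) (l i + d) < 0) \<and>
      (\<forall>i\<in>{1..degree q}. poly (Q e) (m i - d) * poly (Q e) (m i + d) < 0)"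
    using d by (intro eventually_conj eventually_ball_finite ballI)
      (auto intro!: order_tendstoD(2)[OF tendsto_mult] P Q)
  then show ?thesis
  proof (rule eventually_mono, elim conjE)
    fix e
    assume Pe: "\<forall>i\<in>{1..degree p}. poly (P e) (l i - d) * poly (P e) (l i + d) < 0"
      and Qe: "\<forall>i\<in>{1..degree q}. poly (Q e) (m i - d) * poly (Q e) (m i + d) < 0"
    have "\<forall>i\<in>{1..degree p}. \<exists>x. l i - d < x \<and> x < l i + d \<and> poly (P e) x = 0"
      using Pe \<open>0 < d\<close> poly_IVT[of "l _ - d" "l _ + d" "P e"] by fastforce
    then obtain l' where l': "\<And>i. i \<in> {1..degree p} \<Longrightarrow> l i - d < l' i \<and> l' i < l i + d \<and> poly (P e) (l' i) = 0"
      by metis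
    have "\<forall>i\<in>{1..degree q}. \<exists>x. m i - d < x \<and> x < m i + d \<and> poly (Q e) x = 0"
      using Qe \<open>0 < d\<close> poly_IVT[of "m _ - d" "m _ + d" "Q e"] by fastforce
    then obtain m' where m': "\<And>i. i \<in> {1..degree q} \<Longrightarrow> m i - d < m' i \<and> m' i < m i + d \<and> poly (Q e) (m' i) = 0"
      by metis
    have lm': "l' i < m' i \<and> m' i < l' (i + 1)" if "i \<in> {1..degree q}" for i
    proof -
      have "i \<in> {1..degree p}" "i + 1 \<in> {1..degree p}" using that deg by auto
      then show ?thesis
        using d l'[of i] l'[of "i + 1"] m'[OF that] that by (smt (verit))
    qed
    \<comment> \<open>Monotonicity follows by repeating the chain
      \<open>l' i < m' i < l' (i + 1)\<close>.\<close>
    have l_mono: "l' i < l' j" if "i \<in> {1..degree p}" "j \<in> {1..degree p}" "i < j" for i j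
      using that(3,1,2)
    proof (induction i rule: strict_inc_induct)
      case (base i)
      then show ?case using lm'[of i] deg by auto
    next
      case (step i)
      then show ?case using lm'[of i] deg by force
    qed
    have m_mono: "m' i < m' j" if "i \<in> {1..degree q}" "j \<in> {1..degree q}" "i < j" for i j
    proof -
      have "l' (i + 1) \<le> l' j"
        using that deg l_mono[of "i + 1" j] by (cases "i + 1 = j") auto
      then show ?thesis using lm'[OF that(1)] lm'[OF that(2)] by linarith
    qed
    show "\<exists>l m. simple_roots (P e) (degree p) l \<and> simple_roots (Q e) (degree q) m \<and>
           (\<forall>i\<in>{1..degree q}. l i < m i \<and> m i < l (i + 1))"
      using l' m' l_mono m_mono lm' degs nz
      by (intro exI[of _ l'] exI[of _ m'] conjI ballI simple_rootsI strict_mono_onI) auto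
  qed
qed

section \<open>Weighted matching polynomials\<close>

lemma simple_graph_finite:
  assumes "simple_graph V E"
  shows "finite E" "finite {M. is_matching E M}" "is_matching E M \<Longrightarrow> finite M"
proof -
  show E: "finite E"
    using assms by (intro finite_subset[of E "Pow V"]) (auto simp: simple_graph_def)
  show "finite {M. is_matching E M}"
    using E by (intro finite_subset[of "Collect _" "Pow E"]) (auto simp: is_matching_def)
  show "is_matching E M \<Longrightarrow> finite M"
    using finite_subset[OF _ E] by (auto simp: is_matching_def)
qed

lemma card_matching_le:
  assumes G: "simple_graph V E" and M: "is_matching E M"
  shows "2 * card M \<le> card V"
proof -
  have M': "pairwise disjnt M" "\<And>e. e \<in> M \<Longrightarrow> finite e \<and> card e = 2 \<and> e \<subseteq> V"
    using G M finite_subset by (auto simp: simple_graph_def is_matching_def)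
  then have "card (\<Union>M) = (\<Sum>e\<in>M. card e)"
    by (intro card_Union_disjoint) auto
  also have "\<dots> = 2 * card M" using M' by simp
  finally have "2 * card M = card (\<Union>M)" by simp
  also have "\<dots> \<le> card V" using G M' by (intro card_mono) (auto simp: simple_graph_def)
  finally show ?thesis .
qed

text \<open>Regrouping by size gives a single sum over all matchings, to which bijections between
  matchings apply directly.\<close>

lemma poly_matching_poly:
  assumes "simple_graph V E"
  shows "poly (matching_poly V E w) x =
    (\<Sum>M | is_matching E M. (-1) ^ card M * (\<Prod>e\<in>M. w e) * x ^ (card V - 2 * card M))"
    (is "_ = sum ?h ?M")
proof -
  have "poly (matching_poly V E w) x =
      (\<Sum>k = 0..card V div 2. \<Sum>M | M \<in> ?M \<and> card M = k. ?h M)"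
    by (simp add: matching_poly_def matching_weight_def poly_sum poly_monom sum_distrib_left
        sum_distrib_right mult.assoc)
  also have "\<dots> = sum ?h ?M"
    using card_matching_le[OF assms] simple_graph_finite(2)[OF assms]
    by (intro sum.group) (auto simp: less_eq_div_iff_mult_less_eq mult.commute)
  finally show ?thesis .
qed

text \<open>Only the empty matching contributes to the top coefficient.\<close>

lemma matching_poly_monic:
  assumes "simple_graph V E"
  shows "degree (matching_poly V E w) = card V" "lead_coeff (matching_poly V E w) = 1"
    "matching_poly V E w \<noteq> 0"
proof -
  have "{M. is_matching E M \<and> card M = 0} = {{}}"
    using simple_graph_finite(3)[OF assms] by (auto simp: is_matching_def)
  then have w0: "matching_weight E w 0 = 1" by (simp add: matching_weight_def)
  have "coeff (matching_poly V E w) (card V) =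
      (\<Sum>k = 0..card V div 2. if k = 0 then 1 else 0)"
    unfolding matching_poly_def coeff_sum by (intro sum.cong) (auto simp: w0)
  then have c: "coeff (matching_poly V E w) (card V) = 1" by simp
  moreover have "degree (matching_poly V E w) \<le> card V"
    unfolding matching_poly_def
    by (intro degree_sum_le) (auto intro: order_trans[OF degree_monom_le])
  ultimately show d: "degree (matching_poly V E w) = card V"
    by (metis le_antisym le_degree zero_neq_one)
  show "lead_coeff (matching_poly V E w) = 1" using c d by simp
  show "matching_poly V E w \<noteq> 0" using c by auto
qed

text \<open>Matchings through \<open>{a, b}\<close> arise by inserting it into a matching that
  avoids both ends. The extra edge flips the sign and contributes its weight; the exponent of
  \<open>x\<close> is unchanged, since two vertices go with one edge.\<close>

lemma matching_poly_delete_edge: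
  assumes G: "simple_graph V E" and e: "{a, b} \<in> E"
  shows "matching_poly V E w = matching_poly V (E - {{a, b}}) w -
    smult (w {a, b})
      (matching_poly (V - {a, b}) (delete_vertex_edges (delete_vertex_edges E a) b) w)"
proof -
  have ab: "a \<noteq> b" "a \<in> V" "b \<in> V" "finite V"
    using G e by (auto simp: simple_graph_def dest!: bspec[of _ _ "{a, b}"])
  let ?E' = "delete_vertex_edges (delete_vertex_edges E a) b"
  have E': "?E' = {f \<in> E. a \<notin> f \<and> b \<notin> f}" by (auto simp: delete_vertex_edges_def)
  have G1: "simple_graph V (E - {{a, b}})" using G by (auto simp: simple_graph_def)
  have G2: "simple_graph (V - {a, b}) ?E'" using G by (auto simp: simple_graph_def E')
  have card_V: "card V = card (V - {a, b}) + 2"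
    using ab card_Diff_subset[of "{a, b}" V] card_mono[of V "{a, b}"] by simp
  have split: "{M. is_matching E M} = {M. is_matching (E - {{a, b}}) M} \<union>
      insert {a, b} ` {M. is_matching ?E' M}" (is "?M = ?M1 \<union> _ ` ?M2")
  proof (intro equalityI subsetI)
    fix M assume M: "M \<in> ?M"
    show "M \<in> ?M1 \<union> insert {a, b} ` ?M2"
    proof (cases "{a, b} \<in> M")
      case True
      then have "M - {{a, b}} \<in> ?M2"
        using M by (fastforce simp: is_matching_def E' pairwise_def disjnt_def)
      moreover have "M = insert {a, b} (M - {{a, b}})" using True by auto
      ultimately show ?thesis by blast
    next
      case False
      then show ?thesis using M by (auto simp: is_matching_def)
    qed
  next
    fix M assume "M \<in> ?M1 \<union> insert {a, b} ` ?M2"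
    then show "M \<in> ?M"
      using e by (auto simp: is_matching_def E' pairwise_insert disjnt_def)
  qed
  have disj: "?M1 \<inter> insert {a, b} ` ?M2 = {}" by (auto simp: is_matching_def)
  have notin: "{a, b} \<notin> M" if "is_matching ?E' M" for M
    using that by (auto simp: is_matching_def E')
  have inj: "inj_on (insert {a, b}) ?M2"
    by (rule inj_onI) (metis insert_ident mem_Collect_eq notin)
  have "poly (matching_poly V E w) x = poly (matching_poly V (E - {{a, b}}) w) x -
      w {a, b} * poly (matching_poly (V - {a, b}) ?E' w) x" for x
  proof -
    let ?h = "\<lambda>M. (-1) ^ card M * (\<Prod>e\<in>M. w e) * x ^ (card V - 2 * card M)"
    have "poly (matching_poly V E w) x = sum ?h ?M1 + sum ?h (insert {a, b} ` ?M2)"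
      unfolding poly_matching_poly[OF G] split using disj
      by (intro sum.union_disjoint finite_imageI simple_graph_finite(2)[OF G1]
          simple_graph_finite(2)[OF G2])
    also have "sum ?h (insert {a, b} ` ?M2) = (\<Sum>M\<in>?M2. ?h (insert {a, b} M))"
      by (simp add: sum.reindex[OF inj])
    also have "\<dots> = - (w {a, b} * poly (matching_poly (V - {a, b}) ?E' w) x)"
      unfolding poly_matching_poly[OF G2] sum_distrib_left sum_negf[symmetric]
      using simple_graph_finite(3)[OF G2] notin by (intro sum.cong) (auto simp: card_V)
    finally show ?thesis by (simp add: poly_matching_poly[OF G1])
  qed
  then show ?thesis by (intro poly_eq_poly_eq_iff[THEN iffD1] ext) simp
qed

lemma simple_graph_union:
  assumes "simple_graph V1 E1" "simple_graph V2 E2"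
  shows "simple_graph (V1 \<union> V2) (E1 \<union> E2)"
  using assms by (auto simp: simple_graph_def)

lemma simple_graph_delete_vertex:
  assumes "simple_graph V E"
  shows "simple_graph (V - {v}) (delete_vertex_edges E v)"
  using assms by (auto simp: simple_graph_def delete_vertex_edges_def)

lemma simple_graph_disjoint_edges:
  assumes "simple_graph V1 E1" "simple_graph V2 E2" "V1 \<inter> V2 = {}"
  shows "E1 \<inter> E2 = {}"
proof -
  have False if "e \<in> E1" "e \<in> E2" for e
  proof -
    have "e = {}" "card e = 2" using assms that by (auto simp: simple_graph_def) blast
    then show False by simp
  qed
  then show ?thesis by auto
qed

text \<open>A matching of the disjoint union is a pair of matchings, recovered by intersecting with
  \<open>E1\<close> and \<open>E2\<close>.\<close>

lemma matching_poly_union: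
  assumes G1: "simple_graph V1 E1" and G2: "simple_graph V2 E2" and disj: "V1 \<inter> V2 = {}"
  shows "matching_poly (V1 \<union> V2) (E1 \<union> E2) w = matching_poly V1 E1 w * matching_poly V2 E2 w"
proof -
  have G: "simple_graph (V1 \<union> V2) (E1 \<union> E2)" by (rule simple_graph_union[OF G1 G2])
  have E: "E1 \<inter> E2 = {}" using simple_graph_disjoint_edges[OF assms] .
  have sub: "e \<subseteq> V1" if "e \<in> E1" for e using that G1 by (auto simp: simple_graph_def)
  have sub2: "e \<subseteq> V2" if "e \<in> E2" for e using that G2 by (auto simp: simple_graph_def)
  have dj: "disjnt e f" if "e \<in> E1" "f \<in> E2" for e f
    using sub[OF that(1)] sub2[OF that(2)] disj by (auto simp: disjnt_def)
  let ?M1 = "{M. is_matching E1 M}" and ?M2 = "{M. is_matching E2 M}"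
  have un: "is_matching (E1 \<union> E2) (M \<union> N)" if "is_matching E1 M" "is_matching E2 N" for M N
  proof -
    have "disjnt e f" if "e \<in> M \<union> N" "f \<in> M \<union> N" "e \<noteq> f" for e f
      using that \<open>is_matching E1 M\<close> \<open>is_matching E2 N\<close> dj[of e f] dj[of f e]
      by (auto simp: is_matching_def disjnt_iff dest: pairwiseD)
    then show ?thesis using that by (auto simp: is_matching_def intro: pairwiseI)
  qed
  have int: "is_matching E1 (M \<inter> E1)" "is_matching E2 (M \<inter> E2)" "M \<inter> E1 \<union> M \<inter> E2 = M"
    if "is_matching (E1 \<union> E2) M" for M
    using that unfolding is_matching_def pairwise_def by blast+
  have card_V: "card (V1 \<union> V2) = card V1 + card V2"
    using G1 G2 disj by (intro card_Un_disjoint) (auto simp: simple_graph_def)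
  let ?h = "\<lambda>V M x. (-1) ^ card M * (\<Prod>e\<in>M. w e) * x ^ (card V - 2 * card M)"
  have "poly (matching_poly (V1 \<union> V2) (E1 \<union> E2) w) x =
      poly (matching_poly V1 E1 w) x * poly (matching_poly V2 E2 w) x" for x
  proof -
    have "poly (matching_poly V1 E1 w) x * poly (matching_poly V2 E2 w) x =
        (\<Sum>(M, N)\<in>?M1 \<times> ?M2. ?h V1 M x * ?h V2 N x)"
      unfolding poly_matching_poly[OF G1] poly_matching_poly[OF G2]
      by (simp add: sum_product sum.cartesian_product)
    also have "\<dots> = (\<Sum>M | is_matching (E1 \<union> E2) M. ?h (V1 \<union> V2) M x)"
    proof (rule sum.reindex_bij_witness[of _ "\<lambda>M. (M \<inter> E1, M \<inter> E2)" "\<lambda>(M, N). M \<union> N"])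
      fix MN assume MN: "MN \<in> ?M1 \<times> ?M2"
      then obtain M N where [simp]: "MN = (M, N)" and M: "is_matching E1 M" and N: "is_matching E2 N"
        by auto
      have MN': "M \<subseteq> E1" "N \<subseteq> E2" using M N by (auto simp: is_matching_def)
      then show "(\<lambda>M. (M \<inter> E1, M \<inter> E2)) ((\<lambda>(M, N). M \<union> N) MN) = MN"
        using E by auto
      show "(\<lambda>(M, N). M \<union> N) MN \<in> {M. is_matching (E1 \<union> E2) M}" using un[OF M N] by simp
      have fin: "finite M" "finite N" "M \<inter> N = {}"
        using simple_graph_finite(3)[OF G1 M] simple_graph_finite(3)[OF G2 N] MN' E by auto
      \<comment> \<open>\<open>card_matching_le\<close> rules out truncated subtraction on either
        side.\<close>
      have "card V1 + card V2 - 2 * (card M + card N) = (card V1 - 2 * card M) + (card V2 - 2 * card N)"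
        using card_matching_le[OF G1 M] card_matching_le[OF G2 N] by simp
      then show "?h (V1 \<union> V2) ((\<lambda>(M, N). M \<union> N) MN) x = (case MN of (M, N) \<Rightarrow> ?h V1 M x * ?h V2 N x)"
        using fin by (simp add: card_V card_Un_disjoint prod.union_disjoint power_add)
    qed (use int in auto)
    finally show ?thesis by (simp add: poly_matching_poly[OF G])
  qed
  then show ?thesis by (intro poly_eq_poly_eq_iff[THEN iffD1] ext) simp
qed

lemma matching_poly_cong:
  assumes "\<And>e. e \<in> E \<Longrightarrow> w e = w' e"
  shows "matching_poly V E w = matching_poly V E w'"
proof -
  have "matching_weight E w k = matching_weight E w' k" for k
    unfolding matching_weight_def using assms
    by (intro sum.cong prod.cong) (auto simp: is_matching_def)
  then show ?thesis by (simp add: matching_poly_def)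
qed

text \<open>A matching of \<open>k\<close> edges gains the factor \<open>s ^ (2 * k)\<close>, which
  is what remains of \<open>s ^ card V\<close> against
  \<open>(x / s) ^ (card V - 2 * k)\<close>.\<close>

lemma matching_poly_scale:
  assumes G: "simple_graph V E" and "0 < s"
  shows "matching_poly V E (\<lambda>e. s\<^sup>2 * w e) =
    smult (s ^ card V) (pcompose (matching_poly V E w) [:0, 1 / s:])"
proof -
  have "poly (matching_poly V E (\<lambda>e. s\<^sup>2 * w e)) x =
      s ^ card V * poly (matching_poly V E w) (x / s)" for x
    unfolding poly_matching_poly[OF G] sum_distrib_left
  proof (rule sum.cong[OF refl])
    fix M assume "M \<in> {M. is_matching E M}"
    then have "2 * card M \<le> card V" using card_matching_le[OF G] by simp
    then have "s ^ card V = s ^ (2 * card M) * s ^ (card V - 2 * card M)"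
      by (simp flip: power_add)
    then show "(- 1) ^ card M * (\<Prod>e\<in>M. s\<^sup>2 * w e) * x ^ (card V - 2 * card M) =
        s ^ card V * ((- 1) ^ card M * (\<Prod>e\<in>M. w e) * (x / s) ^ (card V - 2 * card M))"
      using \<open>0 < s\<close> by (simp add: prod.distrib power_mult power_divide)
  qed
  then show ?thesis
    by (intro poly_eq_poly_eq_iff[THEN iffD1] ext) (simp add: poly_pcompose)
qed

text \<open>No matching covers all of an odd vertex set, so every term has a positive power of
  \<open>x\<close>.\<close>

lemma matching_poly_odd:
  assumes G: "simple_graph V E" and "odd (card V)"
  shows "poly (matching_poly V E w) 0 = 0"
  unfolding poly_matching_poly[OF G]
proof (rule sum.neutral, rule ballI)
  fix M assume "M \<in> {M. is_matching E M}"
  then have "2 * card M \<le> card V" using card_matching_le[OF G] by simp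
  moreover have "2 * card M \<noteq> card V" using assms(2) by (metis dvd_triv_left)
  ultimately have "card V - 2 * card M > 0" by simp
  then show "(- 1) ^ card M * (\<Prod>e\<in>M. w e) * 0 ^ (card V - 2 * card M) = 0" by simp
qed

lemma tendsto_matching_poly:
  assumes G: "simple_graph V E"
    and "\<And>e. e \<in> E \<Longrightarrow> ((\<lambda>t. w t e) \<longlongrightarrow> w' e) F"
  shows "((\<lambda>t. poly (matching_poly V E (w t)) x) \<longlongrightarrow> poly (matching_poly V E w') x) F"
  unfolding poly_matching_poly[OF G]
  by (intro tendsto_sum tendsto_mult tendsto_prod tendsto_const assms(2))
     (auto simp: is_matching_def)

text \<open>A matching through an edge of weight 0 contributes nothing. The polynomial of a spanning
  subgraph thus becomes a limit of polynomials of the whole graph.\<close>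

lemma matching_poly_zero_weights:
  assumes G: "simple_graph V E" and "F \<subseteq> E" and zero: "\<And>e. e \<in> E - F \<Longrightarrow> w e = 0"
  shows "matching_poly V E w = matching_poly V F w"
proof -
  have GF: "simple_graph V F" using assms by (auto simp: simple_graph_def)
  have "poly (matching_poly V E w) x = poly (matching_poly V F w) x" for x
    unfolding poly_matching_poly[OF G] poly_matching_poly[OF GF]
  proof (rule sum.mono_neutral_right)
    show "finite {M. is_matching E M}" by (rule simple_graph_finite(2)[OF G])
    show "{M. is_matching F M} \<subseteq> {M. is_matching E M}" using \<open>F \<subseteq> E\<close> by (auto simp: is_matching_def)
    show "\<forall>M\<in>{M. is_matching E M} - {M. is_matching F M}.
        (- 1) ^ card M * (\<Prod>e\<in>M. w e) * x ^ (card V - 2 * card M) = 0"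
    proof
      fix M assume M: "M \<in> {M. is_matching E M} - {M. is_matching F M}"
      then obtain e where "e \<in> M" "e \<in> E - F" by (auto simp: is_matching_def)
      then have "(\<Prod>e\<in>M. w e) = 0"
        using simple_graph_finite(3)[OF G] M zero by (intro prod_zero) auto
      then show "(- 1) ^ card M * (\<Prod>e\<in>M. w e) * x ^ (card V - 2 * card M) = 0" by simp
    qed
  qed
  then show ?thesis by (intro poly_eq_poly_eq_iff[THEN iffD1] ext) simp
qed

lemma matching_poly_no_edges: "matching_poly V {} w = monom 1 (card V)"
proof -
  have "matching_weight {} w k = (if k = 0 then 1 else 0)" for k
  proof -
    have *: "{M. is_matching {} M \<and> card M = k} = (if k = 0 then {{}} else {})"
      by (auto simp: is_matching_def)
    show ?thesis unfolding matching_weight_def * by simp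
  qed
  then have "matching_poly V {} w =
      (\<Sum>k = 0..card V div 2. if k = 0 then monom 1 (card V) else 0)"
    unfolding matching_poly_def by (intro sum.cong) auto
  then show ?thesis by simp
qed

section \<open>Rooted trees assembled by joins\<close>

text \<open>
  If \<open>card S\<close> is odd, \<open>0\<close> is a root of the polynomial of \<open>S\<close> and, by strict interlacing, not of that of
  \<open>S - r\<close>; if \<open>card T\<close> is even, \<open>0\<close> is a root of the polynomial of \<open>T - u\<close> and not of that of \<open>T\<close>.
\<close>

inductive decomposable :: "'a set set \<Rightarrow> 'a set \<Rightarrow> 'a \<Rightarrow> bool" for E where
  single: "decomposable E {r} r"
| join: "decomposable E S r \<Longrightarrow> decomposable E T u \<Longrightarrow> S \<inter> T = {} \<Longrightarrow> {r, u} \<in> E \<Longrightarrow>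
    odd (card S) \<or> even (card T) \<Longrightarrow> decomposable E (S \<union> T) r"

lemma decomposable_finite: "decomposable E S r \<Longrightarrow> finite S \<and> r \<in> S"
  by (induction rule: decomposable.induct) auto

lemma interlacing_common_zero:
  assumes "interlacing p q" "poly p 0 = 0"
  shows "poly q 0 \<noteq> 0"
  using assms by (auto simp: interlacing_def wronskian_def dest: spec[of _ 0])

text \<open>Weights on \<open>F1\<close> are kept, those on \<open>F2\<close> are scaled by
  \<open>s\<^sup>2\<close>, and the new edge gets weight 1. A suitable \<open>s\<close> separates
  the nonzero roots; \<open>parity\<close> takes care of the root 0.\<close>

lemma interlacing_join_weights:
  assumes G1: "simple_graph S F1" and G2: "simple_graph T F2" and disj: "S \<inter> T = {}"
    and r: "r \<in> S" and u: "u \<in> T"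
    and w1: "edge_weighting F1 w1" and w2: "edge_weighting F2 w2"
    and I1: "interlacing (matching_poly S F1 w1) (matching_poly (S - {r}) (delete_vertex_edges F1 r) w1)"
      (is "interlacing ?A ?B")
    and I2: "interlacing (matching_poly T F2 w2) (matching_poly (T - {u}) (delete_vertex_edges F2 u) w2)"
      (is "interlacing ?C ?D")
    and parity: "odd (card S) \<or> even (card T)"
  defines "F \<equiv> insert {r, u} (F1 \<union> F2)"
  shows "\<exists>w. edge_weighting F w \<and>
    interlacing (matching_poly (S \<union> T) F w) (matching_poly (S \<union> T - {r}) (delete_vertex_edges F r) w)"
proof -
  note G1r = simple_graph_delete_vertex[OF G1, of r]
    and G2u = simple_graph_delete_vertex[OF G2, of u]
  have ne: "r \<noteq> u" "r \<notin> T" "u \<notin> S" using r u disj by auto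
  have finS: "finite S" "finite T" using G1 G2 by (auto simp: simple_graph_def)
  have nz: "?B \<noteq> 0" "?C \<noteq> 0" using matching_poly_monic(3) G1r G2 by blast+
  have zero: "\<not> (poly ?B 0 = 0 \<and> poly ?C 0 = 0)"
    using parity
  proof
    assume "odd (card S)"
    then show ?thesis using interlacing_common_zero[OF I1] matching_poly_odd[OF G1] by blast
  next
    assume even: "even (card T)"
    have "card T = Suc (card (T - {u}))" using finS u by (metis card_Suc_Diff1)
    then have "odd (card (T - {u}))" using even by simp
    then show ?thesis using interlacing_common_zero[OF I2] matching_poly_odd[OF G2u] by blast
  qed
  \<comment> \<open>A nonzero common root \<open>b\<close> of \<open>?B\<close> and the rescaled
    \<open>?C\<close> is \<open>s * c\<close> with \<open>c\<close> a root of \<open>?C\<close>, so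
    \<open>s = b / c\<close> is one of finitely many bad values. Pairs with \<open>c = 0\<close>
    contribute \<open>b / 0 = 0\<close>, harmless as \<open>s\<close> is positive.\<close>
  let ?Z = "(\<lambda>(b, c). b / c) ` ({x. poly ?B x = 0} \<times> {x. poly ?C x = 0})"
  have "finite ?Z" using nz by (auto intro!: poly_roots_finite)
  then have "infinite ({0<..} - ?Z)" using infinite_Ioi[of "0::real"] by (rule Diff_infinite_finite)
  then obtain s where s: "0 < s" "s \<notin> ?Z" by (metis DiffE greaterThan_iff infinite_imp_nonempty ex_in_conv)
  define w where "w e = (if e \<in> F2 then s\<^sup>2 * w2 e else if e \<in> F1 then w1 e else 1)" for e
  have F12: "F1 \<inter> F2 = {}" by (rule simple_graph_disjoint_edges[OF G1 G2 disj])
  have ru: "{r, u} \<notin> F1" "{r, u} \<notin> F2" using G1 G2 ne by (auto simp: simple_graph_def)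
  have w_pos: "edge_weighting F w"
    using w1 w2 s by (auto simp: edge_weighting_def F_def w_def)
  have A: "matching_poly S F1 w = ?A" and B: "matching_poly (S - {r}) (delete_vertex_edges F1 r) w = ?B"
    using F12 by (auto intro!: matching_poly_cong simp: w_def delete_vertex_edges_def)
  let ?C' = "matching_poly T F2 w" and ?D' = "matching_poly (T - {u}) (delete_vertex_edges F2 u) w"
  have C: "?C' = smult (s ^ card T) (pcompose ?C [:0, 1 / s:])"
    unfolding matching_poly_scale[OF G2 s(1), symmetric]
    by (intro matching_poly_cong) (auto simp: w_def)
  have D: "?D' = smult (s ^ card (T - {u})) (pcompose ?D [:0, 1 / s:])"
    unfolding matching_poly_scale[OF G2u s(1), symmetric]
    by (intro matching_poly_cong) (auto simp: w_def delete_vertex_edges_def)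
  have I2': "interlacing ?C' ?D'"
    using interlacing_scale[OF I2 s(1)] unfolding C D
    by (simp add: matching_poly_monic(1)[OF G2] matching_poly_monic(1)[OF G2u])
  have coprime: "poly ?C' x \<noteq> 0" if "poly ?B x = 0" for x
  proof
    assume "poly ?C' x = 0"
    then have root: "poly ?C (x / s) = 0" using s by (simp add: C poly_pcompose)
    show False
    proof (cases "x = 0")
      case True
      then show ?thesis using root that zero by simp
    next
      case False
      then have "s = x / (x / s)" by simp
      then have "s \<in> ?Z" using root that by (intro image_eqI[of _ _ "(x, x / s)"]) auto
      then show ?thesis using s by simp
    qed
  qed
  have GF: "simple_graph (S \<union> T) F"
    using simple_graph_union[OF G1 G2] r u ne by (auto simp: simple_graph_def F_def)
  \<comment> \<open>Without the new edge the graph splits into \<open>S\<close> and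
    \<open>T\<close>, without \<open>r\<close> into \<open>S - {r}\<close> and \<open>T\<close>,
    without both ends into \<open>S - {r}\<close> and \<open>T - {u}\<close>; the polynomials factor
    accordingly.\<close>
  have F_minus: "F - {{r, u}} = F1 \<union> F2" using ru by (auto simp: F_def)
  have r_F2: "r \<notin> e" if "e \<in> F2" for e using that G2 ne by (auto simp: simple_graph_def)
  have u_F1: "u \<notin> e" if "e \<in> F1" for e using that G1 ne by (auto simp: simple_graph_def)
  have F_r: "delete_vertex_edges F r = delete_vertex_edges F1 r \<union> F2"
    using r_F2 by (auto simp: F_def delete_vertex_edges_def)
  have F_ru: "delete_vertex_edges (delete_vertex_edges F r) u
      = delete_vertex_edges F1 r \<union> delete_vertex_edges F2 u"
    using u_F1 by (auto simp: F_r) (auto simp: delete_vertex_edges_def)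
  have V_r: "S \<union> T - {r} = (S - {r}) \<union> T" and V_ru: "S \<union> T - {r, u} = (S - {r}) \<union> (T - {u})"
    using ne by auto
  have "{r, u} \<in> F" by (simp add: F_def)
  then have "matching_poly (S \<union> T) F w = ?A * ?C' - smult (w {r, u}) (?B * ?D')"
    using disj unfolding matching_poly_delete_edge[OF GF \<open>{r, u} \<in> F\<close>] F_minus F_ru V_ru
    by (subst (1 2) matching_poly_union) (auto simp: A B G1 G2 G1r G2u)
  moreover have "matching_poly (S \<union> T - {r}) (delete_vertex_edges F r) w = ?B * ?C'"
    using disj unfolding F_r V_r by (subst matching_poly_union) (auto simp: B G2 G1r)
  moreover have "0 < w {r, u}" using w_pos \<open>{r, u} \<in> F\<close> by (auto simp: edge_weighting_def)
  ultimately show ?thesis using interlacing_join[OF I1 I2' _ coprime] w_pos by metis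
qed

lemma decomposable_interlacing:
  assumes "decomposable E S r"
  shows "\<exists>F w. F \<subseteq> E \<and> simple_graph S F \<and> edge_weighting F w \<and>
    interlacing (matching_poly S F w) (matching_poly (S - {r}) (delete_vertex_edges F r) w)"
  using assms
proof (induction rule: decomposable.induct)
  case (single r)
  \<comment> \<open>A single vertex gives the polynomials \<open>x\<close> and 1, with Wronskian
    1.\<close>
  have "interlacing (monom 1 1) (monom 1 0)"
    by (rule interlacingI) (simp_all add: degree_monom_eq wronskian_def pderiv_monom)
  then show ?case
    by (intro exI[of _ "{}"])
       (simp add: simple_graph_def edge_weighting_def delete_vertex_edges_def matching_poly_no_edges)
next
  case (join S r T u)
  then obtain F1 w1 F2 w2 where
    F1: "F1 \<subseteq> E" "simple_graph S F1" "edge_weighting F1 w1"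
      "interlacing (matching_poly S F1 w1) (matching_poly (S - {r}) (delete_vertex_edges F1 r) w1)"
    and F2: "F2 \<subseteq> E" "simple_graph T F2" "edge_weighting F2 w2"
      "interlacing (matching_poly T F2 w2) (matching_poly (T - {u}) (delete_vertex_edges F2 u) w2)"
    by blast
  have ru: "r \<in> S" "u \<in> T" using decomposable_finite[OF join.hyps(1)] decomposable_finite[OF join.hyps(2)] by auto
  then have "simple_graph (S \<union> T) (insert {r, u} (F1 \<union> F2))"
    using simple_graph_union[OF F1(2) F2(2)] join.hyps(3)
    by (cases "r = u") (auto simp: simple_graph_def)
  moreover have "insert {r, u} (F1 \<union> F2) \<subseteq> E" using F1 F2 join.hyps by auto
  ultimately show ?case
    using interlacing_join_weights[OF F1(2) F2(2) join.hyps(3) ru F1(3) F2(3) F1(4) F2(4) join.hyps(5)]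
    by blast
qed

text \<open>Edges outside \<open>F\<close> get weight \<open>t\<close>. At \<open>t = 0\<close> the
  polynomials are those of \<open>F\<close>, and their strict interlacing persists for small
  positive \<open>t\<close>, where all weights are admissible.\<close>

theorem decomposable_SRSI:
  assumes dec: "decomposable E V u" and G: "simple_graph V E" and "2 \<le> card V"
  shows "\<exists>w. SRSI V E w u"
proof -
  obtain F w where F: "F \<subseteq> E" "simple_graph V F" "edge_weighting F w"
    and I: "interlacing (matching_poly V F w) (matching_poly (V - {u}) (delete_vertex_edges F u) w)"
    using decomposable_interlacing[OF dec] by blast
  have u: "u \<in> V" "finite V" using decomposable_finite[OF dec] by auto
  define wt where "wt t = (\<lambda>e. if e \<in> F then w e else t)" for t :: real
  note Gu = simple_graph_delete_vertex[OF G, of u]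
  have p: "matching_poly V F w = matching_poly V E (wt 0)"
    using F by (subst matching_poly_zero_weights[OF G, of F]) (auto simp: wt_def intro!: matching_poly_cong)
  have q: "matching_poly (V - {u}) (delete_vertex_edges F u) w =
      matching_poly (V - {u}) (delete_vertex_edges E u) (wt 0)"
    using F by (subst matching_poly_zero_weights[OF Gu, of "delete_vertex_edges F u"])
      (auto simp: wt_def delete_vertex_edges_def intro!: matching_poly_cong)
  have lim: "((\<lambda>t. wt t e) \<longlongrightarrow> wt 0 e) (at_right 0)" for e
    by (auto simp: wt_def tendsto_ident_at)
  define good where "good t \<longleftrightarrow> (\<exists>l m. simple_roots (matching_poly V E (wt t)) (card V) l \<and>
      simple_roots (matching_poly (V - {u}) (delete_vertex_edges E u) (wt t)) (card (V - {u})) m \<and>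
      (\<forall>i\<in>{1..card (V - {u})}. l i < m i \<and> m i < l (i + 1)))" for t
  have "\<forall>\<^sub>F t in at_right 0. good t"
    using interlacing_perturb[OF I, where P = "\<lambda>t. matching_poly V E (wt t)" and F = "at_right 0"
        and Q = "\<lambda>t. matching_poly (V - {u}) (delete_vertex_edges E u) (wt t)"]
    unfolding p q good_def
    by (simp add: matching_poly_monic[OF G] matching_poly_monic[OF Gu] lim
        tendsto_matching_poly[OF G] tendsto_matching_poly[OF Gu])
  then have "\<forall>\<^sub>F t in at_right 0. 0 < t \<and> good t"
    by (rule eventually_conj[OF eventually_at_right_less])
  then obtain t where t: "0 < t" "good t"
    using eventually_happens'[OF trivial_limit_at_right_real] by blast
  have "weighted_graph V E (wt t)"
    using G F t(1) by (auto simp: weighted_graph_def edge_weighting_def wt_def)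
  then have "SRSI V E (wt t) u"
    using t(2) u \<open>2 \<le> card V\<close> by (simp add: SRSI_def good_def)
  then show ?thesis by blast
qed

section \<open>Growing trees along a matching\<close>

lemma decomposable_edge:
  assumes "{x, y} \<in> E" "x \<noteq> y"
  shows "decomposable E {x, y} x"
  using decomposable.join[OF decomposable.single decomposable.single, of x y E] assms
  by (simp add: insert_commute)

text \<open>The path \<open>y\<close>, \<open>z\<close> is pushed down through the joins to the
  singleton \<open>x\<close>, where it is joined as a two-vertex tree. Two extra vertices change no
  parity, so every join on the way remains allowed.\<close>

lemma decomposable_attach:
  assumes "decomposable E S r" "x \<in> S" "y \<notin> S" "z \<notin> S" "y \<noteq> z" "{x, y} \<in> E" "{y, z} \<in> E"
  shows "decomposable E (S \<union> {y, z}) r"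
  using assms
proof (induction rule: decomposable.induct)
  case (single r)
  then have "decomposable E ({r} \<union> {y, z}) r"
    by (intro decomposable.join[OF decomposable.single decomposable_edge]) auto
  then show ?case by simp
next
  case (join S r T u)
  have fin: "finite S" "finite T" using join.hyps(1,2) by (blast dest: decomposable_finite)+
  show ?case
  proof (cases "x \<in> S")
    case True
    then have "decomposable E (S \<union> {y, z}) r" using join by auto
    then have "decomposable E ((S \<union> {y, z}) \<union> T) r"
      using join.hyps join.prems fin by (intro decomposable.join[of _ _ _ T u]) auto
    then show ?thesis by (simp add: Un_ac)
  next
    case False
    then have "decomposable E (T \<union> {y, z}) u" using join by auto
    then have "decomposable E (S \<union> (T \<union> {y, z})) r"
      using join.hyps join.prems fin by (intro decomposable.join[OF join.hyps(1)]) auto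
    then show ?thesis by (simp add: Un_ac)
  qed
qed

text \<open>All roots are kept available because the vertex at which \<open>K\<close> will be joined
  is unknown while \<open>K\<close> grows. Even size makes \<open>insert y K\<close> odd, as its
  join with one further vertex requires.\<close>

definition evenly_decomposable :: "'a set set \<Rightarrow> 'a set \<Rightarrow> bool" where
  "evenly_decomposable E K \<longleftrightarrow> even (card K) \<and> (\<forall>x\<in>K. decomposable E K x)"

lemma evenly_decomposable_edge:
  assumes "{x, y} \<in> E" "x \<noteq> y"
  shows "evenly_decomposable E {x, y}"
  using decomposable_edge[of x y E] decomposable_edge[of y x E] assms
  by (auto simp: evenly_decomposable_def insert_commute)

lemma decomposable_insert:
  assumes "evenly_decomposable E K" "x \<in> K" "y \<notin> K" "{x, y} \<in> E"
  shows "decomposable E (insert y K) y"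
proof -
  have "decomposable E ({y} \<union> K) y"
    using assms by (intro decomposable.intros(2)[of _ _ _ _ x] decomposable.intros(1))
      (auto simp: evenly_decomposable_def insert_commute)
  then show ?thesis by simp
qed

text \<open>Root \<open>y\<close> comes from joining \<open>{z}\<close> to
  \<open>insert y K\<close>, root \<open>z\<close> from the opposite join, and the old roots from
  \<open>decomposable_attach\<close>. In both joins the part holding the root is odd.\<close>

lemma evenly_decomposable_attach:
  assumes K: "evenly_decomposable E K" and x: "x \<in> K" "{x, y} \<in> E"
    and yz: "y \<notin> K" "z \<notin> K" "y \<noteq> z" "{y, z} \<in> E"
  shows "evenly_decomposable E (K \<union> {y, z})"
proof -
  have K': "even (card K)" "decomposable E K x" using K x by (auto simp: evenly_decomposable_def)
  have fin: "finite K" using decomposable_finite[OF K'(2)] by simp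
  have y: "decomposable E (insert y K) y" using decomposable_insert[OF K x(1) yz(1) x(2)] .
  have "decomposable E (insert y K \<union> {z}) y"
    using y yz K' fin by (intro decomposable.intros(2)[of _ _ _ _ z] decomposable.intros(1)) auto
  moreover have "decomposable E ({z} \<union> insert y K) z"
    using y yz K' fin
    by (intro decomposable.intros(2)[of _ _ _ _ y] decomposable.intros(1)) (auto simp: insert_commute)
  moreover have "decomposable E (K \<union> {y, z}) a" if "a \<in> K" for a
    using K x yz that by (intro decomposable_attach) (auto simp: evenly_decomposable_def)
  ultimately show ?thesis
    using K' yz fin by (auto simp: evenly_decomposable_def insert_commute)
qed

lemma perfect_matching_mate:
  assumes G: "simple_graph V E" and M: "perfect_matching U E M" and "y \<in> U"
  obtains z where "z \<in> U" "z \<noteq> y" "{y, z} \<in> E" "perfect_matching (U - {y, z}) E (M - {{y, z}})"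
proof -
  have M': "M \<subseteq> E" "pairwise disjnt M" "\<Union>M = U"
    using M by (auto simp: perfect_matching_def is_matching_def)
  obtain e where e: "e \<in> M" "y \<in> e" using M' \<open>y \<in> U\<close> by auto
  then have "card e = 2" using G M' by (auto simp: simple_graph_def)
  then obtain z where z: "e = {y, z}" "z \<noteq> y" using e(2) by (auto simp: card_2_iff)
  have "\<Union>(M - {e}) = U - e"
    using M' e(1) by (auto simp: pairwise_def disjnt_def)
  moreover have "is_matching E (M - {e})" using M' by (auto simp: is_matching_def pairwise_def)
  ultimately show ?thesis
    using that[of z] z e M' by (auto simp: perfect_matching_def)
qed

lemma connected_graph_cut:
  assumes G: "simple_graph V E" and conn: "connected_graph V E"
    and "x \<in> K" "K \<subseteq> V" "K \<noteq> V"
  obtains a b where "a \<in> K" "b \<in> V - K" "{a, b} \<in> E"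
proof (rule ccontr)
  assume no: "\<not> thesis"
  obtain y where y: "y \<in> V - K" using assms by auto
  have "(x, y) \<in> {(a, b). {a, b} \<in> E}\<^sup>*"
    using conn assms y by (auto simp: connected_graph_def)
  then have "y \<in> K"
  proof (induction rule: rtrancl_induct)
    case (step b c)
    then have "c \<in> V" using G by (auto simp: simple_graph_def)
    then show ?case using step that no by auto
  qed (use assms in simp)
  then show False using y by simp
qed

text \<open>By connectedness some edge leaves \<open>K\<close>; its outer end and the mate of that
  end are absorbed together. When a single matched pair \<open>y\<close>, \<open>z\<close> is left,
  \<open>z\<close> is deleted and \<open>K\<close> hangs below the root \<open>y\<close>.\<close>

lemma leaf_removal_perfect:
  assumes G: "simple_graph V E" "connected_graph V E"
    and "K \<union> U = V" "K \<inter> U = {}" "K \<noteq> {}" "evenly_decomposable E K"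
    and "U \<noteq> {}" "perfect_matching U E M"
  shows "\<exists>v\<in>V. \<exists>u. {u, v} \<in> E \<and> decomposable E (V - {v}) u"
  using assms(3-)
proof (induction "card U" arbitrary: K U M rule: less_induct)
  case less
  have fin: "finite U" using G less.prems by (auto simp: simple_graph_def)
  obtain x where "x \<in> K" using less.prems(3) by auto
  moreover have "K \<subseteq> V" "K \<noteq> V" using less.prems(1,2,5) by auto
  ultimately obtain a y where a: "a \<in> K" "{a, y} \<in> E" and "y \<in> V - K"
    using connected_graph_cut[OF G] by metis
  then have y: "y \<in> U" "y \<notin> K" using less.prems(1) by auto
  obtain z where z: "z \<in> U" "z \<noteq> y" "{y, z} \<in> E" "perfect_matching (U - {y, z}) E (M - {{y, z}})"
    using perfect_matching_mate[OF G(1) less.prems(6) y(1)] .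
  have zK: "z \<notin> K" using z less.prems by auto
  show ?case
  proof (cases "U = {y, z}")
    case True
    then have "V - {z} = insert y K" using z zK less.prems(1) by auto
    moreover have "decomposable E (insert y K) y"
      using decomposable_insert[OF less.prems(4) a(1) y(2) a(2)] .
    ultimately show ?thesis using z less.prems(1) by (intro bexI[of _ z] exI[of _ y]) auto
  next
    case False
    have "evenly_decomposable E (K \<union> {y, z})"
      using evenly_decomposable_attach[OF less.prems(4) a y(2) zK] z by auto
    moreover have "card (U - {y, z}) < card U"
      using fin y by (intro psubset_card_mono) auto
    ultimately show ?thesis
      using less.prems y z False by (intro less.hyps[OF _ _ _ _ _ _ z(4), of "K \<union> {y, z}"]) auto
  qed
qed

text \<open>
  The unmatched vertex \<open>r\<close> moves during the induction: if all edges leaving \<open>K \<union> {r}\<close> start at \<open>r\<close>,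
  then \<open>r\<close> and its new neighbour \<open>y\<close> are absorbed into \<open>K\<close>, and the mate of \<open>y\<close> becomes unmatched.
\<close>

lemma leaf_removal_nearly_perfect:
  assumes G: "simple_graph V E" "connected_graph V E"
    and "insert r (K \<union> U) = V" "r \<notin> K" "r \<notin> U" "K \<inter> U = {}" "evenly_decomposable E K"
    and "k \<in> K" "{k, r} \<in> E" "perfect_matching U E M"
  shows "\<exists>v\<in>V. \<exists>u. {u, v} \<in> E \<and> decomposable E (V - {v}) u"
  using assms(3-)
proof (induction "card U" arbitrary: r K U M k rule: less_induct)
  case less
  have fin: "finite U" using G less.prems by (auto simp: simple_graph_def)
  show ?case
  proof (cases "U = {}")
    case True
    \<comment> \<open>All matched vertices are absorbed, so the unmatched \<open>r\<close> is
      deleted and its neighbour \<open>k\<close> is the root.\<close>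
    then have "V - {r} = K" using less.prems by auto
    then show ?thesis
      using less.prems by (intro bexI[of _ r] exI[of _ k]) (auto simp: evenly_decomposable_def)
  next
    case False
    \<comment> \<open>The cut is taken at \<open>insert r K\<close>, not at \<open>K\<close>, so
      that the new endpoint \<open>y\<close> has a mate.\<close>
    then have "insert r K \<subseteq> V" "insert r K \<noteq> V" using less.prems(1,3,4) by auto
    then obtain a y where a: "a \<in> insert r K" "{a, y} \<in> E" and "y \<in> V - insert r K"
      using connected_graph_cut[OF G insertI1] by metis
    then have y: "y \<in> U" "y \<notin> insert r K" using less.prems(1) by auto
    obtain z where z: "z \<in> U" "z \<noteq> y" "{y, z} \<in> E" "perfect_matching (U - {y, z}) E (M - {{y, z}})"
      using perfect_matching_mate[OF G(1) less.prems(8) y(1)] .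
    have zK: "z \<notin> K" "z \<noteq> r" using z less.prems by auto
    have smaller: "card (U - {y, z}) < card U" using fin y by (intro psubset_card_mono) auto
    show ?thesis
    proof (cases "a = r")
      case True
      have "evenly_decomposable E (K \<union> {r, y})"
        using evenly_decomposable_attach[OF less.prems(5,6,7,2)] a y True by auto
      then show ?thesis
        using less.prems y z zK
        by (intro less.hyps[OF smaller _ _ _ _ _ _ _ z(4), of z "K \<union> {r, y}" y]) auto
    next
      case False
      then have "evenly_decomposable E (K \<union> {y, z})"
        using evenly_decomposable_attach[OF less.prems(5), of a y z] a y z zK by auto
      then show ?thesis
        using less.prems y z zK
        by (intro less.hyps[OF smaller _ _ _ _ _ _ _ z(4), of r "K \<union> {y, z}" k]) auto
    qed
  qed
qed

lemma leaf_removal: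
  assumes G: "simple_graph V E" "connected_graph V E" and card_V: "3 \<le> card V"
    and M: "perfect_matching V E M \<or> nearly_perfect_matching V E M"
  shows "\<exists>v\<in>V. \<exists>u. {u, v} \<in> E \<and> decomposable E (V - {v}) u"
  using M
proof
  assume M: "perfect_matching V E M"
  obtain x where x: "x \<in> V" using card_V by fastforce
  obtain y where y: "y \<in> V" "y \<noteq> x" "{x, y} \<in> E" "perfect_matching (V - {x, y}) E (M - {{x, y}})"
    using perfect_matching_mate[OF G(1) M x] .
  \<comment> \<open>Three vertices guarantee that a matched pair remains outside the initial
    edge.\<close>
  have "V \<noteq> {x, y}" using card_V y by auto
  then show ?thesis
    using x y evenly_decomposable_edge[OF y(3)]
    by (intro leaf_removal_perfect[OF G _ _ _ _ _ y(4)]) auto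
next
  assume "nearly_perfect_matching V E M"
  then obtain r where r: "r \<in> V" "perfect_matching (V - {r}) E M"
    by (auto simp: nearly_perfect_matching_def perfect_matching_def)
  have "{r} \<noteq> V" using card_V by auto
  then obtain y where y: "{r, y} \<in> E" "y \<in> V - {r}"
    using connected_graph_cut[OF G, of r "{r}"] r by blast
  obtain z where z: "z \<in> V - {r}" "z \<noteq> y" "{y, z} \<in> E"
      "perfect_matching (V - {r} - {y, z}) E (M - {{y, z}})"
    using perfect_matching_mate[OF G(1) r(2) y(2)] .
  \<comment> \<open>The unmatched vertex moves at once: \<open>r\<close> and its neighbour
    \<open>y\<close> form the initial \<open>K\<close>, and the mate \<open>z\<close> of
    \<open>y\<close> replaces \<open>r\<close>.\<close>
  have "evenly_decomposable E {r, y}" using y by (intro evenly_decomposable_edge) auto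
  then show ?thesis
    using y z r by (intro leaf_removal_nearly_perfect[OF G _ _ _ _ _ _ _ z(4), of z "{r, y}" y]) auto
qed

section \<open>Passing to the graph without \<open>v\<close>\<close>

text \<open>Every joining edge lies inside the set being assembled, so the induced subgraph
  suffices. For \<open>S = V - {v}\<close> this is the graph without \<open>v\<close>.\<close>

lemma decomposable_restrict:
  assumes "decomposable E S r"
  shows "decomposable {e \<in> E. e \<subseteq> S} S r"
proof -
  have mono: "decomposable E' S r" if "decomposable E S r" "\<And>e. e \<in> E \<Longrightarrow> e \<subseteq> S \<Longrightarrow> e \<in> E'" for E' S r
    using that
  proof (induction rule: decomposable.induct)
    case (join S r T u)
    have ru: "r \<in> S" "u \<in> T" using join.hyps(1,2) by (blast dest: decomposable_finite)+
    have "decomposable E' S r" "decomposable E' T u" using join.IH join.prems by blast+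
    moreover have "{r, u} \<in> E'" using join.hyps(4) join.prems ru by blast
    ultimately show ?case using join.hyps(3,5) by (intro decomposable.join)
  qed (rule decomposable.single)
  show ?thesis using assms by (rule mono) auto
qed

text \<open>The witness \<open>?S\<close>, the neighbours of \<open>v\<close> other than
  \<open>u\<close>, provides the new edges beyond \<open>{u, v}\<close>; \<open>c\<close> weights
  all edges at \<open>v\<close>.\<close>

lemma graph_expansion_delete_vertex:
  assumes G: "simple_graph V E" and "v \<in> V" "{u, v} \<in> E"
    and w: "edge_weighting (delete_vertex_edges E v) w"
    and c: "edge_weighting (E - delete_vertex_edges E v) c"
  shows "graph_expansion (V - {v}) (delete_vertex_edges E v) w u v
    V E (override_on c w (delete_vertex_edges E v))"
proof -
  let ?S = "{x. {v, x} \<in> E \<and> x \<noteq> u}"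
  have edge: "e \<subseteq> V" "card e = 2" if "e \<in> E" for e using G that by (auto simp: simple_graph_def)
  have "u \<in> V" "u \<noteq> v" using edge[OF \<open>{u, v} \<in> E\<close>] by auto
  have "?S \<subseteq> V - {v} - {u}" using edge by fastforce
  moreover have "E = delete_vertex_edges E v \<union> {{u, v}} \<union> (\<lambda>x. {v, x}) ` ?S"
  proof (intro equalityI subsetI)
    fix e assume e: "e \<in> E"
    show "e \<in> delete_vertex_edges E v \<union> {{u, v}} \<union> (\<lambda>x. {v, x}) ` ?S"
    proof (cases "v \<in> e")
      case True
      then obtain x where "e = {v, x}" using edge(2)[OF e] by (auto simp: card_2_iff)
      then show ?thesis using e by (cases "x = u") (auto simp: insert_commute)
    qed (use e in \<open>auto simp: delete_vertex_edges_def\<close>)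
  qed (use assms(3) in \<open>auto simp: delete_vertex_edges_def\<close>)
  moreover have "edge_weighting E (override_on c w (delete_vertex_edges E v))"
    using w c by (auto simp: edge_weighting_def override_on_def)
  moreover have "weighted_graph (V - {v}) (delete_vertex_edges E v) w"
    using simple_graph_delete_vertex[OF G] w by (simp add: weighted_graph_def)
  ultimately show ?thesis
    using \<open>u \<in> V\<close> \<open>u \<noteq> v\<close> \<open>v \<in> V\<close> unfolding graph_expansion_def by auto
qed

text \<open>The quantifier over \<open>c\<close> expresses that the edges at \<open>v\<close> may
  carry any positive weights.\<close>

theorem corollary3p11:
  fixes V :: "'a set" and E :: "'a set set"
  assumes "simple_graph V E"
    and "connected_graph V E"
    and "3 \<le> card V"
    and "\<exists>M. perfect_matching V E M \<or> nearly_perfect_matching V E M"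
  shows "\<exists>v\<in>V. \<exists>u. {u, v} \<in> E \<and>
    (\<exists>w. edge_weighting (delete_vertex_edges E v) w \<and>
      SRSI (V - {v}) (delete_vertex_edges E v) w u \<and>
      (\<forall>c. edge_weighting (E - delete_vertex_edges E v) c \<longrightarrow>
        graph_expansion (V - {v}) (delete_vertex_edges E v) w u v
          V E (override_on c w (delete_vertex_edges E v))))"
proof -
  obtain v u where v: "v \<in> V" "{u, v} \<in> E" "decomposable E (V - {v}) u"
    using leaf_removal assms by metis
  have "{e \<in> E. e \<subseteq> V - {v}} = delete_vertex_edges E v"
    using assms(1) by (auto simp: simple_graph_def delete_vertex_edges_def)
  then have "decomposable (delete_vertex_edges E v) (V - {v}) u"
    using decomposable_restrict[OF v(3)] by simp
  moreover have "2 \<le> card (V - {v})" using assms(3) v(1) by simp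
  ultimately obtain w where w: "SRSI (V - {v}) (delete_vertex_edges E v) w u"
    using decomposable_SRSI[OF _ simple_graph_delete_vertex[OF assms(1)]] by blast
  then have "edge_weighting (delete_vertex_edges E v) w"
    by (simp add: SRSI_def weighted_graph_def)
  then show ?thesis
    using v w graph_expansion_delete_vertex[OF assms(1) v(1,2)] by blast
qed

end
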